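(* Let $z=(\nu,x)\in M_\Omega(n,\mathfrak e)$. Let $U$ be a connected (Euclidean) open neighborhood of $x$ in $M_\Omega(n)$ and $\phi:U\to\mathfrak e_{\Omega(n)}$ an analytic map such that the map $\mathrm{graph}\,\phi:U\to \mathfrak e_{\Omega(n)}\times M_\Omega(n)$, $y\mapsto(\phi(y),y)$, has the following properties: $\mathrm{graph}\,\phi(x)=z$; its image $U_z$ is contained in $M_\Omega(n,\mathfrak e)$, and $\mathrm{graph}\,\phi:U\to U_z$ is a homeomorphism; $\pi_n^{-1}(U)=\bigsqcup_{\sigma\in\Sigma_n}\sigma\cdot U_z$; and the sets $\sigma\cdot U_z$ ($\sigma\in\Sigma_n$) are the connected components of $\pi_n^{-1}(U)$ and are open in $M_\Omega(n,\mathfrak e)$. Then the map $$\pi_n|U_z:U_z\to U$$ is an analytic isomorphism. In particular $\pi_n:M_\Omega(n,\mathfrak e)\to M_\Omega(n)$ is an étale morphism.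
   Context: Fix a positive integer $n$; $I_k=\{1,\dots,k\}$, $d(k)=k(k+1)/2$. $M(n)$ is the space of complex $n\times n$ matrices; for $x\in M(n)$ and $m\in I_n$, $x_m$ is the upper left $m\times m$ block of $x$. $M_\Omega(n)$ is the Zariski open set of all $x\in M(n)$ such that $x_m$ has $m$ distinct eigenvalues for every $m\in I_n$, and $x_m,x_{m+1}$ have no common eigenvalue for every $m\in I_{n-1}$. $\mathfrak e_{\Omega(n)}$ is the set of all $\nu=(\nu(1),\dots,\nu(n))$, $\nu(m)=\mathrm{diag}(\nu_{1\,m},\dots,\nu_{m\,m})$, such that for each $m\in I_n$ the numbers $\nu_{1\,m},\dots,\nu_{m\,m}$ are distinct and $\nu_{i\,m}\ne\nu_{j\,m+1}$ for all $m\in I_{n-1}$, $i\in I_m$, $j\in I_{m+1}$; it is a Zariski open subset of $\mathbb C^{d(n)}$. Let $$M_\Omega(n,\mathfrak e)=\{(\nu,x)\in\mathfrak e_{\Omega(n)}\times M_\Omega(n)\mid \nu(m)\text{ is } Gl(m)\text{-conjugate to }x_m\ \forall m\in I_n\},$$ with $\pi_n(\nu,x)=x$; it is a nonsingular affine variety of dimension $n^2$, hence a complex manifold. The group $\Sigma_n=S_1\times\cdots\times S_n$ acts freely on it by $\sigma\cdot(\nu,x)=(\sigma\cdot\nu,x)$, $(\sigma\cdot\nu)_{i\,m}=\nu_{\sigma_m^{-1}(i)\,m}$. For every $z\in M_\Omega(n,\mathfrak e)$ a pair $(U,\phi)$ with the properties listed in the claim exists. *)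

theory Defs
  imports
    "HOL-Analysis.Analysis"
    "HOL-Combinatorics.Permutations"
    "HOL-Library.Disjoint_Sets"
    "Jordan_Normal_Form.Spectral_Radius"
begin

no_notation Matrix.vec_index (infixl "$" 100)

section \<open>Complex vector spaces\<close>

text \<open>The library has no class of complex vector spaces.  The one below makes the space of complex
  square matrices and products of such spaces complex vector spaces, with their usual topology.\<close>

class complex_space = real_normed_vector +
  fixes scaleC :: "complex \<Rightarrow> 'a \<Rightarrow> 'a"  (infixr "*\<^sub>C" 75)
  assumes scaleC_add_right: "c *\<^sub>C (v + w) = c *\<^sub>C v + c *\<^sub>C w"
    and scaleC_add_left: "(c + d) *\<^sub>C v = c *\<^sub>C v + d *\<^sub>C v"
    and scaleC_scaleC: "c *\<^sub>C (d *\<^sub>C v) = (c * d) *\<^sub>C v"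
    and scaleC_of_real: "complex_of_real r *\<^sub>C v = r *\<^sub>R v"

instantiation complex :: complex_space
begin
definition scaleC_complex :: "complex \<Rightarrow> complex \<Rightarrow> complex"
  where "scaleC_complex c v = c * v"
instance
  by standard (simp_all add: scaleC_complex_def algebra_simps scaleR_conv_of_real)
end

instantiation Finite_Cartesian_Product.vec :: (complex_space, finite) complex_space
begin
definition scaleC_vec :: "complex \<Rightarrow> 'a ^ 'b \<Rightarrow> 'a ^ 'b"
  where "scaleC_vec c v = (\<chi> i. c *\<^sub>C v $ i)"
instance
  by standard (simp_all add: scaleC_vec_def Finite_Cartesian_Product.vec_eq_iff
      scaleC_add_right scaleC_add_left scaleC_scaleC scaleC_of_real)
end

instantiation prod :: (complex_space, complex_space) complex_space
begin
definition scaleC_prod :: "complex \<Rightarrow> 'a \<times> 'b \<Rightarrow> 'a \<times> 'b"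
  where "scaleC_prod c v = (c *\<^sub>C fst v, c *\<^sub>C snd v)"
instance
  by standard (simp_all add: scaleC_prod_def prod_eq_iff scaleC_add_right scaleC_add_left
      scaleC_scaleC scaleC_of_real)
end

definition complex_linear :: "('a::complex_space \<Rightarrow> 'b::complex_space) \<Rightarrow> bool"
  where "complex_linear f \<longleftrightarrow> bounded_linear f \<and> (\<forall>c v. f (c *\<^sub>C v) = c *\<^sub>C f v)"


section \<open>Analytic maps\<close>

definition complex_differentiable_at :: "('a::complex_space \<Rightarrow> 'b::complex_space) \<Rightarrow> 'a \<Rightarrow> bool"
  where "complex_differentiable_at f a \<longleftrightarrow> (\<exists>f'. (f has_derivative f') (at a) \<and> complex_linear f')"

text \<open>As with the library's notion for one variable, analytic means locally extendable to a
  complex differentiable map on an open set.  For an open set this is the usual notion, and for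
  an embedded complex submanifold of \<^typ>\<open>'a\<close> it is analyticity with respect to the
  induced complex structure.  Likewise, a map into an embedded submanifold is analytic iff it is
  analytic as a map into the ambient space.\<close>

definition analytic_map_on :: "('a::complex_space \<Rightarrow> 'b::complex_space) \<Rightarrow> 'a set \<Rightarrow> bool"
  where "analytic_map_on f S \<longleftrightarrow>
    (\<forall>a\<in>S. \<exists>W g. open W \<and> a \<in> W \<and> (\<forall>w\<in>W. complex_differentiable_at g w) \<and>
                (\<forall>w\<in>S \<inter> W. g w = f w))"

definition analytic_isomorphism ::
    "'a::complex_space set \<Rightarrow> 'b::complex_space set \<Rightarrow> ('a \<Rightarrow> 'b) \<Rightarrow> bool"
  where "analytic_isomorphism S T f \<longleftrightarrow>
    bij_betw f S T \<and> analytic_map_on f S \<and> analytic_map_on (inv_into S f) T"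


section \<open>Etale morphisms of nonsingular varieties\<close>

text \<open>The complex polynomial functions, generated as in the library's
  \<^const>\<open>real_polynomial_function\<close>.\<close>

inductive polynomial_fun :: "('a::complex_space \<Rightarrow> complex) \<Rightarrow> bool"
  where
    linear: "complex_linear f \<Longrightarrow> polynomial_fun f"
  | const: "polynomial_fun (\<lambda>w. c)"
  | add: "polynomial_fun f \<Longrightarrow> polynomial_fun g \<Longrightarrow> polynomial_fun (\<lambda>w. f w + g w)"
  | mult: "polynomial_fun f \<Longrightarrow> polynomial_fun g \<Longrightarrow> polynomial_fun (\<lambda>w. f w * g w)"

definition polynomial_map :: "('a::complex_space \<Rightarrow> 'b::complex_space) \<Rightarrow> bool"
  where "polynomial_map P \<longleftrightarrow> (\<forall>l. complex_linear l \<longrightarrow> polynomial_fun (\<lambda>w. l (P w)))"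

text \<open>The Jacobian criterion: near each point the set is cut out, in a Zariski open set
  \<open>q \<noteq> 0\<close> of the ambient space, by polynomials with linearly independent differentials.
  In particular such a set is Zariski locally closed.\<close>

definition nonsingular_variety :: "'a::complex_space set \<Rightarrow> bool"
  where "nonsingular_variety X \<longleftrightarrow>
    (\<forall>a\<in>X. \<exists>q F. polynomial_fun q \<and> q a \<noteq> 0 \<and> finite F \<and> (\<forall>p\<in>F. polynomial_fun p) \<and>
       (\<forall>w. q w \<noteq> 0 \<longrightarrow> (w \<in> X \<longleftrightarrow> (\<forall>p\<in>F. p w = 0))) \<and>
       (\<forall>c :: ('a \<Rightarrow> complex) \<Rightarrow> complex.
          (\<forall>v. (\<Sum>p\<in>F. c p * frechet_derivative p (at a) v) = 0) \<longrightarrow> (\<forall>p\<in>F. c p = 0)))"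

definition zariski_tangent_space :: "'a::complex_space set \<Rightarrow> 'a \<Rightarrow> 'a set"
  where "zariski_tangent_space X a =
    {v. \<forall>p. polynomial_fun p \<and> (\<forall>w\<in>X. p w = 0) \<longrightarrow> frechet_derivative p (at a) v = 0}"

text \<open>\<open>g\<close> represents \<open>f\<close> near \<open>a\<close> as a quotient of polynomials.  On the
  tangent space of \<open>X\<close> at \<open>a\<close> the derivative of \<open>g\<close> does not depend on the
  choice of \<open>g\<close>; it is the differential of \<open>f\<close> at \<open>a\<close>.\<close>

definition regular_representation ::
    "'a::complex_space set \<Rightarrow> ('a \<Rightarrow> 'b::complex_space) \<Rightarrow> 'a \<Rightarrow> ('a \<Rightarrow> 'b) \<Rightarrow> bool"
  where "regular_representation X f a g \<longleftrightarrow>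
    (\<exists>P q. polynomial_map P \<and> polynomial_fun q \<and> q a \<noteq> 0 \<and> g = (\<lambda>w. inverse (q w) *\<^sub>C P w) \<and>
           (\<forall>w\<in>X. q w \<noteq> 0 \<longrightarrow> f w = g w))"

definition regular_map ::
    "'a::complex_space set \<Rightarrow> 'b::complex_space set \<Rightarrow> ('a \<Rightarrow> 'b) \<Rightarrow> bool"
  where "regular_map X Y f \<longleftrightarrow> f ` X \<subseteq> Y \<and> (\<forall>a\<in>X. \<exists>g. regular_representation X f a g)"

text \<open>A morphism of nonsingular varieties over an algebraically closed field is etale if its
  differential is an isomorphism of tangent spaces at every point.\<close>

definition etale_morphism ::
    "'a::complex_space set \<Rightarrow> 'b::complex_space set \<Rightarrow> ('a \<Rightarrow> 'b) \<Rightarrow> bool"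
  where "etale_morphism X Y f \<longleftrightarrow>
    nonsingular_variety X \<and> nonsingular_variety Y \<and> regular_map X Y f \<and>
    (\<forall>a\<in>X. \<exists>g. regular_representation X f a g \<and>
       bij_betw (frechet_derivative g (at a))
         (zariski_tangent_space X a) (zariski_tangent_space Y (f a)))"


section \<open>Matrices with generic upper left blocks\<close>

text \<open>The index set \<open>{1, ..., n}\<close> is an arbitrary finite linearly ordered type
  \<^typ>\<open>'n\<close> with \<open>n\<close> elements.  An index \<open>m\<close> corresponds to the number
  \<open>card {..m}\<close>, and \<open>enum_index\<close> lists the indices increasingly from position 0.\<close>

type_synonym 'n cmatrix = "complex ^ 'n ^ 'n"

definition enum_index :: "nat \<Rightarrow> 'n::{finite, linorder}"
  where "enum_index k = sorted_list_of_set UNIV ! k"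

definition next_index :: "'n::linorder \<Rightarrow> 'n \<Rightarrow> bool"
  where "next_index m m' \<longleftrightarrow> m < m' \<and> {m<..<m'} = {}"

definition upper_left_block :: "'n cmatrix \<Rightarrow> 'n::{finite, linorder} \<Rightarrow> complex mat"
  where "upper_left_block x m =
    Matrix.mat (card {..m}) (card {..m}) (\<lambda>(i, j). x $ enum_index i $ enum_index j)"

definition M_Omega :: "'n::{finite, linorder} cmatrix set"
  where "M_Omega = {x.
    (\<forall>m. card (spectrum (upper_left_block x m)) = card {..m}) \<and>
    (\<forall>m m'. next_index m m' \<longrightarrow>
       spectrum (upper_left_block x m) \<inter> spectrum (upper_left_block x m') = {})}"

text \<open>A tuple \<open>\<nu>\<close> of numbers \<open>\<nu>\<^sub>i\<^sub>m\<close> with \<open>i \<le> m\<close> is encoded as the square array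
  with \<open>\<nu> $ m $ i = \<nu>\<^sub>i\<^sub>m\<close> for \<open>i \<le> m\<close> and 0 elsewhere, so that
  \<open>\<complex>\<close> to the power \<open>n(n+1)/2\<close> becomes a linear subspace of the
  space of complex square matrices.\<close>

definition diagonal_block :: "'n cmatrix \<Rightarrow> 'n::{finite, linorder} \<Rightarrow> complex mat"
  where "diagonal_block \<nu> m = mat_diag (card {..m}) (\<lambda>i. \<nu> $ m $ enum_index i)"

definition e_Omega :: "'n::{finite, linorder} cmatrix set"
  where "e_Omega = {\<nu>.
    (\<forall>m i. m < i \<longrightarrow> \<nu> $ m $ i = 0) \<and>
    (\<forall>m. inj_on (\<lambda>i. \<nu> $ m $ i) {..m}) \<and>
    (\<forall>m m' i j. next_index m m' \<and> i \<le> m \<and> j \<le> m' \<longrightarrow> \<nu> $ m $ i \<noteq> \<nu> $ m' $ j)}"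

definition M_Omega_e :: "('n::{finite, linorder} cmatrix \<times> 'n cmatrix) set"
  where "M_Omega_e = {(\<nu>, x). \<nu> \<in> e_Omega \<and> x \<in> M_Omega \<and>
    (\<forall>m. similar_mat (diagonal_block \<nu> m) (upper_left_block x m))}"

definition pi_n :: "'n cmatrix \<times> 'n cmatrix \<Rightarrow> 'n cmatrix"
  where "pi_n = snd"

text \<open>The product of the symmetric groups of \<open>{..m}\<close>, with permutations extended by the identity.\<close>

definition Sigma_n :: "('n::{finite, linorder} \<Rightarrow> 'n \<Rightarrow> 'n) set"
  where "Sigma_n = {\<sigma>. \<forall>m. \<sigma> m permutes {..m}}"

definition Sigma_act :: "('n::{finite, linorder} \<Rightarrow> 'n \<Rightarrow> 'n) \<Rightarrow>
    'n cmatrix \<times> 'n cmatrix \<Rightarrow> 'n cmatrix \<times> 'n cmatrix"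
  where "Sigma_act \<sigma> = (\<lambda>(\<nu>, x). (\<chi> m i. \<nu> $ m $ inv_into UNIV (\<sigma> m) i, x))"

definition graph_map :: "('a \<Rightarrow> 'b) \<Rightarrow> 'a \<Rightarrow> 'b \<times> 'a"
  where "graph_map \<phi> y = (\<phi> y, y)"

end

theory Submission
  imports
    Defs
    "HOL-Computational_Algebra.Field_as_Ring"
    "Subresultants.Subresultant_Gcd"
begin

no_notation Matrix.vec_index (infixl "$" 100)

text \<open>The inverse of the projection of \<open>U\<^sub>z\<close> to \<open>U\<close> is the graph map of \<open>\<phi>\<close>, which is analytic.

  \<open>M_Omega\<close> is the principal open set on which a product of resultants of characteristic polynomials
  (and of their derivatives) of the blocks does not vanish.  On the principal open set where the
  \<open>\<nu>\<^sub>i\<^sub>m\<close> are distinct as required, \<open>M_Omega_e\<close> is cut out by the equations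
  \<open>p\<^sub>m(\<nu>\<^sub>i\<^sub>m) = 0\<close> for \<open>i \<le> m\<close>, with \<open>p\<^sub>m\<close> the characteristic polynomial of \<open>x\<^sub>m\<close>, together with
  \<open>\<nu>\<^sub>i\<^sub>m = 0\<close> for \<open>i > m\<close>.  The roots being simple, the Jacobian of these equations with respect
  to \<open>\<nu>\<close> is an invertible diagonal matrix; this gives nonsingularity and, by the inverse function
  theorem, the bijectivity of the differential of the projection.\<close>

section \<open>Polynomial functions\<close>

lemma complex_linear_bounded_linear: "complex_linear f \<Longrightarrow> bounded_linear f"
  by (simp add: complex_linear_def)

lemma complex_linear_compose:
  assumes "complex_linear f" "complex_linear g"
  shows "complex_linear (\<lambda>v. f (g v))"
  using assms by (auto simp: complex_linear_def bounded_linear_compose)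

lemma complex_linear_fst: "complex_linear fst"
  by (simp add: complex_linear_def bounded_linear_fst scaleC_prod_def)

lemma complex_linear_snd: "complex_linear snd"
  by (simp add: complex_linear_def bounded_linear_snd scaleC_prod_def)

lemma complex_linear_vec_nth: "complex_linear (\<lambda>v :: 'a::complex_space ^ 'i. v $ i)"
  by (simp add: complex_linear_def bounded_linear_vec_nth scaleC_vec_def)

lemma complex_linear_entry: "complex_linear (\<lambda>x :: complex ^ 'i ^ 'j. x $ j $ i)"
  using complex_linear_compose[OF complex_linear_vec_nth complex_linear_vec_nth] .

lemma polynomial_fun_compose_linear:
  assumes "polynomial_fun f" "complex_linear g"
  shows "polynomial_fun (\<lambda>w. f (g w))"
  using assms(1)
  by induction (auto intro: polynomial_fun.intros complex_linear_compose[OF _ assms(2)])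

lemma polynomial_fun_minus:
  assumes "polynomial_fun f" shows "polynomial_fun (\<lambda>w. - f w)"
  using polynomial_fun.mult[OF polynomial_fun.const[of "-1"] assms] by simp

lemma polynomial_fun_diff:
  assumes "polynomial_fun f" "polynomial_fun g" shows "polynomial_fun (\<lambda>w. f w - g w)"
  using polynomial_fun.add[OF assms(1) polynomial_fun_minus[OF assms(2)]] by simp

lemma polynomial_fun_sum:
  "(\<And>i. i \<in> I \<Longrightarrow> polynomial_fun (f i)) \<Longrightarrow> polynomial_fun (\<lambda>w. \<Sum>i\<in>I. f i w)"
  by (induction I rule: infinite_finite_induct) (auto intro: polynomial_fun.intros)

lemma polynomial_fun_prod:
  "(\<And>i. i \<in> I \<Longrightarrow> polynomial_fun (f i)) \<Longrightarrow> polynomial_fun (\<lambda>w. \<Prod>i\<in>I. f i w)"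
  by (induction I rule: infinite_finite_induct) (auto intro: polynomial_fun.intros)

lemma polynomial_fun_power:
  "polynomial_fun f \<Longrightarrow> polynomial_fun (\<lambda>w. f w ^ k)"
  by (induction k) (auto intro: polynomial_fun.intros)

lemma polynomial_fun_if:
  "polynomial_fun f \<Longrightarrow> polynomial_fun g \<Longrightarrow> polynomial_fun (\<lambda>w. if b then f w else g w)"
  by (cases b) simp_all

lemma polynomial_fun_det:
  assumes "\<And>w. A w \<in> carrier_mat n n"
    and "\<And>i j. i < n \<Longrightarrow> j < n \<Longrightarrow> polynomial_fun (\<lambda>w. A w $$ (i, j))"
  shows "polynomial_fun (\<lambda>w. det (A w))"
proof -
  have "polynomial_fun (\<lambda>w. \<Sum>p | p permutes {0..<n}. signof p * (\<Prod>i = 0..<n. A w $$ (i, p i)))"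
    by (intro polynomial_fun_sum polynomial_fun.mult polynomial_fun_prod polynomial_fun.const assms(2))
       (use permutes_in_image in fastforce)+
  then show ?thesis
    by (simp add: det_def'[OF assms(1)])
qed

section \<open>Characteristic polynomials and resultants depending on a parameter\<close>

definition polynomial_family :: "('a::complex_space \<Rightarrow> complex poly) \<Rightarrow> bool"
  where "polynomial_family P \<longleftrightarrow> (\<forall>k. polynomial_fun (\<lambda>w. coeff (P w) k))"

lemma polynomial_family_const: "polynomial_family (\<lambda>w. p)"
  by (simp add: polynomial_family_def polynomial_fun.const)

lemma polynomial_family_pCons:
  assumes "polynomial_fun f" "polynomial_family P"
  shows "polynomial_family (\<lambda>w. pCons (f w) (P w))"
  unfolding polynomial_family_def
proof
  fix k
  show "polynomial_fun (\<lambda>w. coeff (pCons (f w) (P w)) k)"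
    using assms by (cases k) (auto simp: polynomial_family_def)
qed

lemma polynomial_family_add:
  "polynomial_family P \<Longrightarrow> polynomial_family Q \<Longrightarrow> polynomial_family (\<lambda>w. P w + Q w)"
  by (simp add: polynomial_family_def polynomial_fun.add)

lemma polynomial_family_mult:
  "polynomial_family P \<Longrightarrow> polynomial_family Q \<Longrightarrow> polynomial_family (\<lambda>w. P w * Q w)"
  unfolding polynomial_family_def coeff_mult
  by (intro allI polynomial_fun_sum polynomial_fun.mult) auto

lemma polynomial_family_sum:
  "(\<And>i. i \<in> I \<Longrightarrow> polynomial_family (P i)) \<Longrightarrow> polynomial_family (\<lambda>w. \<Sum>i\<in>I. P i w)"
  by (simp add: polynomial_family_def coeff_sum polynomial_fun_sum)

lemma polynomial_family_prod:
  "(\<And>i. i \<in> I \<Longrightarrow> polynomial_family (P i)) \<Longrightarrow> polynomial_family (\<lambda>w. \<Prod>i\<in>I. P i w)"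
  by (induction I rule: infinite_finite_induct)
     (auto intro: polynomial_family_const polynomial_family_mult)

lemma polynomial_family_pderiv:
  "polynomial_family P \<Longrightarrow> polynomial_family (\<lambda>w. pderiv (P w))"
  unfolding polynomial_family_def coeff_pderiv
  by (intro allI polynomial_fun.mult polynomial_fun.const) auto

lemma polynomial_family_det:
  assumes "\<And>w. A w \<in> carrier_mat n n"
    and "\<And>i j. i < n \<Longrightarrow> j < n \<Longrightarrow> polynomial_family (\<lambda>w. A w $$ (i, j))"
  shows "polynomial_family (\<lambda>w. det (A w))"
proof -
  have "polynomial_family (\<lambda>w. \<Sum>p | p permutes {0..<n}. signof p * (\<Prod>i = 0..<n. A w $$ (i, p i)))"
    by (intro polynomial_family_sum polynomial_family_mult polynomial_family_prod
          polynomial_family_const assms(2)) (use permutes_in_image in fastforce)+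
  then show ?thesis
    by (simp add: det_def'[OF assms(1)])
qed

lemma polynomial_family_char_poly:
  assumes "\<And>w. A w \<in> carrier_mat n n"
    and "\<And>i j. i < n \<Longrightarrow> j < n \<Longrightarrow> polynomial_fun (\<lambda>w. A w $$ (i, j))"
  shows "polynomial_family (\<lambda>w. char_poly (A w))"
  unfolding char_poly_def
proof (rule polynomial_family_det[where n = n])
  show "char_poly_matrix (A w) \<in> carrier_mat n n" for w
    using assms(1) by simp
  fix i j assume ij: "i < n" "j < n"
  have "char_poly_matrix (A w) $$ (i, j)
      = (if i = j then [:0, 1:] else 0) + [:- (A w $$ (i, j)):]" for w
    using assms(1)[of w] ij by (auto simp: char_poly_matrix_def)
  moreover have "polynomial_family
      (\<lambda>w. (if i = j then [:0, 1:] else 0) + [:- (A w $$ (i, j)):])"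
    using ij by (intro polynomial_family_add polynomial_family_const polynomial_family_pCons
        polynomial_fun_minus assms(2))
  ultimately show "polynomial_family (\<lambda>w. char_poly_matrix (A w) $$ (i, j))"
    by presburger
qed

lemma polynomial_fun_poly:
  assumes "polynomial_family P" "polynomial_fun f" "\<And>w. degree (P w) = n"
  shows "polynomial_fun (\<lambda>w. poly (P w) (f w))"
  unfolding poly_altdef assms(3)
  using assms(1) by (intro polynomial_fun_sum polynomial_fun.mult polynomial_fun_power assms(2))
    (auto simp: polynomial_family_def)

text \<open>Constant degrees fix the size of the Sylvester matrix. Its entries are coefficients or
  0, so its determinant is polynomial in the parameter.\<close>

lemma polynomial_fun_resultant:
  assumes "polynomial_family P" "polynomial_family Q"
    and "\<And>w. degree (P w) = m" "\<And>w. degree (Q w) = n"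
  shows "polynomial_fun (\<lambda>w. resultant (P w) (Q w))"
proof -
  have "polynomial_fun (\<lambda>w. det (sylvester_mat_sub m n (P w) (Q w)))"
  proof (rule polynomial_fun_det[OF sylvester_mat_sub_carrier])
    fix i j assume "i < m + n" "j < m + n"
    then show "polynomial_fun (\<lambda>w. sylvester_mat_sub m n (P w) (Q w) $$ (i, j))"
      using assms(1,2)
      by (auto simp: sylvester_mat_sub_index polynomial_family_def
          intro!: polynomial_fun_if polynomial_fun.const)
  qed
  then show ?thesis
    by (simp add: resultant_def sylvester_mat_def assms(3,4))
qed

text \<open>Continuity of the derivative is stated vector by vector, which passes through sums and
  products directly. In finite dimension it gives continuity in operator norm, as required by the
  inverse function theorem.\<close>

lemma polynomial_fun_C1:
  fixes f :: "'a::complex_space \<Rightarrow> complex"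
  assumes "polynomial_fun f"
  shows "\<exists>f'. (\<forall>w. (f has_derivative f' w) (at w)) \<and> (\<forall>v. continuous_on UNIV (\<lambda>w. f' w v))"
  using assms
proof induction
  case (linear f)
  then have "bounded_linear f" by (rule complex_linear_bounded_linear)
  then show ?case
    by (intro exI[of _ "\<lambda>w. f"]) (auto intro: bounded_linear_imp_has_derivative)
next
  case (const c)
  show ?case by (intro exI[of _ "\<lambda>w v. 0"]) auto
next
  case (add f g)
  then obtain f' g' where
    "\<And>w. (f has_derivative f' w) (at w)" "\<And>v. continuous_on UNIV (\<lambda>w. f' w v)"
    "\<And>w. (g has_derivative g' w) (at w)" "\<And>v. continuous_on UNIV (\<lambda>w. g' w v)"
    by auto
  then show ?case
    by (intro exI[of _ "\<lambda>w v. f' w v + g' w v"])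
       (auto intro!: has_derivative_add continuous_intros)
next
  case (mult f g)
  then obtain f' g' where f': "\<And>w. (f has_derivative f' w) (at w)"
    "\<And>v. continuous_on UNIV (\<lambda>w. f' w v)"
    and g': "\<And>w. (g has_derivative g' w) (at w)" "\<And>v. continuous_on UNIV (\<lambda>w. g' w v)"
    by auto
  have "continuous_on UNIV f" "continuous_on UNIV g"
    using f'(1) g'(1) by (meson has_derivative_continuous continuous_at_imp_continuous_on)+
  with f' g' show ?case
    by (intro exI[of _ "\<lambda>w v. f w * g' w v + f' w v * g w"])
       (auto intro!: has_derivative_mult continuous_intros)
qed

lemma polynomial_fun_has_derivative:
  "polynomial_fun f \<Longrightarrow> (f has_derivative frechet_derivative f (at w)) (at w)"
  using polynomial_fun_C1[of f] frechet_derivative_works differentiableI by blast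

lemma continuous_on_frechet_derivative_polynomial_fun:
  assumes "polynomial_fun f"
  shows "continuous_on UNIV (\<lambda>w. frechet_derivative f (at w) v)"
proof -
  obtain f' where f': "\<And>w. (f has_derivative f' w) (at w)" "\<And>v. continuous_on UNIV (\<lambda>w. f' w v)"
    using polynomial_fun_C1[OF assms] by auto
  then have "frechet_derivative f (at w) = f' w" for w
    by (metis frechet_derivative_at)
  then show ?thesis using f'(2) by simp
qed

lemma continuous_polynomial_fun: "polynomial_fun f \<Longrightarrow> isCont f w"
  using polynomial_fun_has_derivative has_derivative_continuous by blast

section \<open>Simple roots\<close>

text \<open>At a multiple root \<open>a\<close>, the quotient \<open>q\<close> of \<open>p\<close>
  by \<open>X - a\<close> still vanishes at \<open>a\<close>. Then \<open>q\<close> has the same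
  roots as \<open>p\<close> but degree one less, too small for that many roots.\<close>

lemma simple_root_of_card_roots:
  fixes p :: "complex poly"
  assumes "p \<noteq> 0" "card {z. poly p z = 0} = degree p" "poly p a = 0"
  shows "poly (pderiv p) a \<noteq> 0"
proof
  assume "poly (pderiv p) a = 0"
  obtain q where q: "p = [:-a, 1:] * q"
    using assms(3) by (auto simp: poly_eq_0_iff_dvd)
  have "pderiv p = [:-a, 1:] * pderiv q + q"
    by (simp only: q pderiv_mult) (simp add: pderiv_pCons)
  then have "poly q a = 0"
    using \<open>poly (pderiv p) a = 0\<close> by simp
  have "q \<noteq> 0" using assms(1) q by auto
  have "{z. poly p z = 0} = {z. poly q z = 0}"
    using \<open>poly q a = 0\<close> by (auto simp: q)
  moreover have "card {z. poly q z = 0} \<le> degree q"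
    using \<open>q \<noteq> 0\<close> by (rule card_poly_roots_bound)
  moreover have "degree p = Suc (degree q)"
    using \<open>q \<noteq> 0\<close> by (simp add: q degree_mult_eq del: mult_pCons_left)
  ultimately show False using assms(2) by simp
qed

text \<open>A complex polynomial without multiple roots is a constant times the product of the
  factors \<open>X - z\<close> over its roots, so its degree counts them.\<close>

lemma card_roots_iff_simple:
  fixes p :: "complex poly"
  assumes "p \<noteq> 0"
  shows "card {z. poly p z = 0} = degree p \<longleftrightarrow> (\<forall>z. \<not> (poly p z = 0 \<and> poly (pderiv p) z = 0))"
proof
  assume "\<forall>z. \<not> (poly p z = 0 \<and> poly (pderiv p) z = 0)"
  then have "rsquarefree p" by (simp add: rsquarefree_roots)
  then have "Polynomial.smult (lead_coeff p) (\<Prod>z | poly p z = 0. [:-z, 1:]) = p"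
    by (rule complex_poly_decompose_rsquarefree)
  then have "degree p = degree (\<Prod>z | poly p z = 0. [:-z, 1:])"
    using assms by (metis degree_smult_eq leading_coeff_0_iff)
  also have "\<dots> = (\<Sum>z | poly p z = 0. degree [:-z, 1:])"
    by (rule degree_prod_eq_sum_degree) auto
  finally show "card {z. poly p z = 0} = degree p" by simp
qed (use simple_root_of_card_roots[OF assms] in auto)

text \<open>The resultant vanishes iff the gcd is nonconstant. Over the complex numbers this means
  that the gcd has a root, and its roots are the common roots.\<close>

lemma resultant_eq_0_iff_common_root:
  fixes p q :: "complex poly"
  assumes "p \<noteq> 0"
  shows "resultant p q = 0 \<longleftrightarrow> (\<exists>z. poly p z = 0 \<and> poly q z = 0)"
proof -
  have g: "gcd p q \<noteq> 0" using assms by simp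
  have "degree (gcd p q) \<noteq> 0 \<longleftrightarrow> (\<exists>z. poly (gcd p q) z = 0)"
  proof
    assume "degree (gcd p q) \<noteq> 0"
    then show "\<exists>z. poly (gcd p q) z = 0"
      by (intro fundamental_theorem_of_algebra) (simp add: constant_degree)
  next
    assume "\<exists>z. poly (gcd p q) z = 0"
    then obtain z where "[:-z, 1:] dvd gcd p q" by (auto simp: poly_eq_0_iff_dvd)
    from dvd_imp_degree_le[OF this g] show "degree (gcd p q) \<noteq> 0" by simp
  qed
  then show ?thesis by (simp add: resultant_0_gcd poly_eq_0_iff_dvd)
qed

section \<open>Matrices with simple spectrum\<close>

lemma char_poly_mat_diag: "char_poly (mat_diag n f) = (\<Prod>i\<leftarrow>[0..<n]. [:- f i, 1:])"
proof -
  have "diag_mat (mat_diag n f) = map f [0..<n]"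
    by (auto simp: diag_mat_def mat_diag_def)
  moreover have "upper_triangular (mat_diag n f)"
    by (auto simp: upper_triangular_def mat_diag_def)
  ultimately show ?thesis
    using char_poly_upper_triangular[of "mat_diag n f" n] by (simp add: comp_def)
qed

text \<open>The kernel of the matrix \<open>P\<close> of eigenvectors is stable under \<open>D - \<mu>\<close> for every \<open>\<mu>\<close>;
  a kernel vector with a minimal number of nonzero entries thus has only one.\<close>

lemma eigenvectors_det_nonzero:
  fixes A P :: "'a::field mat"
  assumes A: "A \<in> carrier_mat n n" and P: "P \<in> carrier_mat n n"
    and AP: "A * P = P * mat_diag n f"
    and inj: "inj_on f {..<n}"
    and nz: "\<And>i. i < n \<Longrightarrow> col P i \<noteq> 0\<^sub>v n"
  shows "det P \<noteq> 0"
proof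
  define K where "K = {c \<in> carrier_vec n. c \<noteq> 0\<^sub>v n \<and> P *\<^sub>v c = 0\<^sub>v n}"
  define supp where "supp c = {i. i < n \<and> vec_index c i \<noteq> (0::'a)}" for c
  let ?D = "mat_diag n f"
  have D: "?D \<in> carrier_mat n n" by simp
  assume "det P = 0"
  then have "K \<noteq> {}"
    using det_0_iff_vec_prod_zero_field[OF P] by (auto simp: K_def)
  then obtain c where c: "c \<in> K" and min: "\<And>d. d \<in> K \<Longrightarrow> card (supp c) \<le> card (supp d)"
    using ex_has_least_nat[of "\<lambda>c. c \<in> K" _ "\<lambda>c. card (supp c)"] by blast
  have cc: "c \<in> carrier_vec n" and c0: "c \<noteq> 0\<^sub>v n" and Pc: "P *\<^sub>v c = 0\<^sub>v n"
    using c by (auto simp: K_def)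
  obtain i where i: "i < n" "vec_index c i \<noteq> 0"
    using cc c0 by (metis carrier_vecD eq_vecI index_zero_vec)
  have fin: "finite (supp d)" for d by (simp add: supp_def)
  have Dv: "vec_index (?D *\<^sub>v c) k = f k * vec_index c k" if "k < n" for k
  proof -
    have "vec_index (?D *\<^sub>v c) k = (\<Sum>l = 0..<n. (if k = l then f l else 0) * vec_index c l)"
      using that cc by (simp add: mat_diag_def scalar_prod_def)
    also have "\<dots> = (\<Sum>l = 0..<n. if l = k then f l * vec_index c l else 0)"
      by (rule sum.cong) auto
    finally show ?thesis using that by simp
  qed
  have single: "vec_index c j = 0" if j: "j < n" "j \<noteq> i" for j
  proof (rule ccontr)
    assume cj: "vec_index c j \<noteq> 0"
    \<comment> \<open>Entry k of \<open>c\<close> gets multiplied by \<open>f k - f j\<close>. The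
      support thus loses j, keeps i because \<open>f\<close> is injective, and gains
      nothing.\<close>
    define d where "d = ?D *\<^sub>v c - f j \<cdot>\<^sub>v c"
    have dc: "d \<in> carrier_vec n" using mult_mat_vec_carrier[OF D cc] cc by (simp add: d_def)
    have dk: "vec_index d k = (f k - f j) * vec_index c k" if "k < n" for k
      using that cc by (simp add: d_def Dv algebra_simps)
    have "P *\<^sub>v (?D *\<^sub>v c) = A *\<^sub>v (P *\<^sub>v c)"
      using A P cc by (metis AP D assoc_mult_mat_vec)
    also have "\<dots> = 0\<^sub>v n" using A by (auto simp: Pc intro!: eq_vecI)
    finally have "P *\<^sub>v d = 0\<^sub>v n"
      unfolding d_def using P cc D
      by (subst mult_minus_distrib_mat_vec[of _ n n])
         (auto simp: mult_mat_vec[of _ n n] Pc mult_mat_vec_carrier[OF D cc])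
    moreover have "vec_index d i \<noteq> 0"
      using i j inj by (auto simp: dk dest: inj_onD)
    then have "d \<noteq> 0\<^sub>v n" using i by auto
    ultimately have "d \<in> K" using dc by (simp add: K_def)
    then have "card (supp c) \<le> card (supp d)" by (rule min)
    moreover have "supp d \<subseteq> supp c" by (auto simp: supp_def dk)
    moreover have "j \<in> supp c" "j \<notin> supp d" using j cj by (simp_all add: supp_def dk)
    ultimately show False by (metis card_seteq fin)
  qed
  \<comment> \<open>As \<open>c\<close> has its only nonzero entry at i,
    \<open>P *\<^sub>v c\<close> is a nonzero multiple of column i.\<close>
  have "col P i = 0\<^sub>v n"
  proof (rule eq_vecI)
    fix k assume "k < dim_vec (0\<^sub>v n :: 'a vec)"
    then have k: "k < n" by simp
    have "0 = vec_index (P *\<^sub>v c) k" using k by (simp add: Pc)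
    also have "\<dots> = (\<Sum>l = 0..<n. P $$ (k, l) * vec_index c l)"
      using k P cc by (simp add: scalar_prod_def)
    also have "\<dots> = (\<Sum>l = 0..<n. if l = i then P $$ (k, i) * vec_index c i else 0)"
      by (rule sum.cong) (auto simp: single)
    also have "\<dots> = P $$ (k, i) * vec_index c i" using i by simp
    finally show "vec_index (col P i) k = vec_index (0\<^sub>v n) k"
      using i k P by simp
  qed (use P in simp)
  then show False using nz i by blast
qed

text \<open>Eigenvectors for the n distinct eigenvalues form the columns of a matrix
  \<open>P\<close> with \<open>A * P = P * mat_diag n f\<close>. It is invertible by the preceding
  lemma, so it diagonalizes \<open>A\<close>.\<close>

lemma similar_mat_diag_of_eigenvalues:
  fixes A :: "'a::field mat"
  assumes A: "A \<in> carrier_mat n n"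
    and inj: "inj_on f {..<n}"
    and ev: "\<And>i. i < n \<Longrightarrow> eigenvalue A (f i)"
  shows "similar_mat (mat_diag n f) A"
proof -
  obtain v where v: "\<And>i. i < n \<Longrightarrow> eigenvector A (v i) (f i)"
    using ev unfolding eigenvalue_def by metis
  then have vc: "\<And>i. i < n \<Longrightarrow> v i \<in> carrier_vec n" and v0: "\<And>i. i < n \<Longrightarrow> v i \<noteq> 0\<^sub>v n"
    and Av: "\<And>i. i < n \<Longrightarrow> A *\<^sub>v v i = f i \<cdot>\<^sub>v v i"
    using A by (auto simp: eigenvector_def)
  define P where "P = Matrix.mat n n (\<lambda>(k, i). vec_index (v i) k)"
  have P: "P \<in> carrier_mat n n" by (simp add: P_def)
  have colP: "col P i = v i" if "i < n" for i
    using that carrier_vecD[OF vc[OF that]] by (intro eq_vecI) (auto simp: P_def)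
  have D: "mat_diag n f \<in> carrier_mat n n" by simp
  have AP: "A * P = P * mat_diag n f"
  proof (rule eq_matI)
    fix k i assume "k < dim_row (P * mat_diag n f)" "i < dim_col (P * mat_diag n f)"
    then have ki: "k < n" "i < n" using P by (auto simp: mat_diag_def)
    have "(A * P) $$ (k, i) = vec_index (A *\<^sub>v v i) k"
      using ki A P by (simp add: colP)
    also have "\<dots> = (P * mat_diag n f) $$ (k, i)"
      using ki carrier_vecD[OF vc] by (simp add: Av mat_diag_mult_right[OF P]) (simp add: P_def)
    finally show "(A * P) $$ (k, i) = (P * mat_diag n f) $$ (k, i)" .
  qed (use A P in \<open>auto simp: mat_diag_def\<close>)
  have "det P \<noteq> 0"
    using v0 by (intro eigenvectors_det_nonzero[OF A P AP inj]) (simp add: colP)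
  from det_non_zero_imp_unit[OF P this]
  obtain Q where Q: "Q \<in> carrier_mat n n" "P * Q = 1\<^sub>m n" "Q * P = 1\<^sub>m n"
    unfolding Units_def by (auto simp: ring_mat_def)
  have "A = A * (P * Q)" using A Q by simp
  also have "\<dots> = A * P * Q" by (rule assoc_mult_mat[OF A P Q(1), symmetric])
  finally have "A = P * mat_diag n f * Q" by (simp only: AP)
  with A P Q D have "similar_mat_wit A (mat_diag n f) P Q"
    unfolding similar_mat_wit_def Let_def by (intro conjI) (simp_all only: carrier_matD insert_subset empty_subsetI simp_thms)
  then have "similar_mat A (mat_diag n f)" unfolding similar_mat_def by blast
  then show ?thesis by (rule similar_mat_sym)
qed

section \<open>Tangent spaces\<close>

lemma open_polynomial_nonzero:
  assumes "polynomial_fun q"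
  shows "open {w. q w \<noteq> 0}"
  using continuous_polynomial_fun[OF assms]
  by (intro open_Collect_neq continuous_at_imp_continuous_on continuous_on_const) auto

text \<open>A polynomial vanishing on \<open>X\<close> is zero on a Euclidean neighborhood of
  \<open>a\<close>, hence has zero derivative there and imposes no condition on tangent
  vectors.\<close>

lemma zariski_tangent_space_principal_open:
  assumes "polynomial_fun q" "q a \<noteq> 0" "\<And>w. q w \<noteq> 0 \<Longrightarrow> w \<in> X"
  shows "zariski_tangent_space X a = UNIV"
proof -
  have "frechet_derivative p (at a) v = 0" if p: "polynomial_fun p" "\<forall>w\<in>X. p w = 0" for p v
  proof -
    have "(p has_derivative (\<lambda>v. 0)) (at a)"
      by (rule has_derivative_transform_within_open[OF has_derivative_const[of 0]
            open_polynomial_nonzero[OF assms(1)]]) (use assms p(2) in auto)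
    then show ?thesis by (metis frechet_derivative_at)
  qed
  then show ?thesis by (auto simp: zariski_tangent_space_def)
qed

lemma has_derivative_vec_lambda:
  fixes f :: "'i::finite \<Rightarrow> 'a::real_normed_vector \<Rightarrow> 'b::euclidean_space"
  assumes "\<And>i. (f i has_derivative f' i) (at a)"
  shows "((\<lambda>x. \<chi> i. f i x) has_derivative (\<lambda>v. \<chi> i. f' i v)) (at a)"
  by (subst has_derivative_componentwise_within)
     (auto simp: Basis_vec_def inner_axis intro: has_derivative_inner_left assms)

section \<open>Equations with diagonal Jacobian\<close>

lemma vec2_entry_axis:
  "(axis j (axis i 1) :: complex ^ 'i ^ 'j) $ l $ k = (if l = j \<and> k = i then 1 else 0)"
  by (simp add: axis_def)

text \<open>Evaluated at the unit vector of position (j, i) in the first factor, the linear relation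
  retains only the term of \<open>f j i\<close>.\<close>

lemma independent_differentials_of_diagonal:
  fixes f :: "'j::finite \<Rightarrow> 'i::finite \<Rightarrow> (complex ^ 'i ^ 'j) \<times> 'b::complex_space \<Rightarrow> complex"
  assumes d: "\<And>j i. d j i \<noteq> 0"
    and df: "\<And>j i \<eta>. frechet_derivative (f j i) (at a) (\<eta>, 0) = d j i * \<eta> $ j $ i"
    and c: "\<And>v. (\<Sum>p\<in>range (\<lambda>(j, i). f j i). c p * frechet_derivative p (at a) v) = 0"
  shows "c (f j i) = 0"
proof -
  let ?F = "range (\<lambda>(j, i). f j i)" and ?v = "(axis j (axis i 1), 0) :: (complex ^ 'i ^ 'j) \<times> 'b"
  \<comment> \<open>The sum runs over a set of functions; a member other than \<open>f j i\<close>
    must come from another index pair, so its differential kills \<open>?v\<close>.\<close>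
  have "c p * frechet_derivative p (at a) ?v = 0" if "p \<in> ?F - {f j i}" for p
    using that by (auto simp: df vec2_entry_axis split: if_splits)
  then have "(\<Sum>p\<in>?F. c p * frechet_derivative p (at a) ?v)
      = (\<Sum>p\<in>{f j i}. c p * frechet_derivative p (at a) ?v)"
    by (intro sum.mono_neutral_right ballI) auto
  then show ?thesis using c[of ?v] d[of j i] by (simp add: df vec2_entry_axis)
qed

text \<open>Surjectivity on tangent spaces: by the inverse function theorem for
  \<open>w \<mapsto> (f w, snd w)\<close>, lines in the second factor lift to differentiable curves in \<open>X\<close>, on which
  the polynomials vanishing on \<open>X\<close> are constant.\<close>

lemma snd_bij_zariski_tangent_space:
  fixes f :: "'j::finite \<Rightarrow> 'i::finite \<Rightarrow>
      (complex ^ 'i ^ 'j) \<times> 'b::{complex_space, euclidean_space} \<Rightarrow> complex"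
  assumes f: "\<And>j i. polynomial_fun (f j i)"
    and q: "polynomial_fun q" "q a \<noteq> 0"
    and X: "\<And>w. q w \<noteq> 0 \<Longrightarrow> w \<in> X \<longleftrightarrow> (\<forall>j i. f j i w = 0)"
    and a: "a \<in> X"
    and f0: "\<And>j i w. w \<in> X \<Longrightarrow> f j i w = 0"
    and d: "\<And>j i. d j i \<noteq> 0"
    and df: "\<And>j i \<eta>. frechet_derivative (f j i) (at a) (\<eta>, 0) = d j i * \<eta> $ j $ i"
  shows "bij_betw snd (zariski_tangent_space X a) UNIV"
proof (rule bij_betw_imageI)
  define T where "T = zariski_tangent_space X a"
  have lin: "linear (frechet_derivative (f j i) (at w))" for j i w
    using polynomial_fun_has_derivative[OF f] has_derivative_linear by blast
  have fT: "frechet_derivative (f j i) (at a) v = 0" if "v \<in> T" for j i v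
    using that f f0 by (auto simp: T_def zariski_tangent_space_def)
  show "inj_on snd (zariski_tangent_space X a)"
    unfolding T_def[symmetric]
  proof (rule inj_onI)
    fix v w assume vw: "v \<in> T" "w \<in> T" "snd v = snd w"
    have "d j i * (fst v - fst w) $ j $ i = 0" for j i
    proof -
      \<comment> \<open>The difference lies in the first factor, where the differentials of the
        equations read off its entries up to the nonzero factors \<open>d j i\<close>.\<close>
      have "v - w = (fst v - fst w, 0)" using vw by (simp add: prod_eq_iff)
      then have "d j i * (fst v - fst w) $ j $ i = frechet_derivative (f j i) (at a) (v - w)"
        by (simp only: df)
      also have "\<dots> = 0" using vw by (simp add: linear_diff[OF lin] fT)
      finally show ?thesis .
    qed
    then have "fst v = fst w" using d by (simp add: Finite_Cartesian_Product.vec_eq_iff)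
    with vw show "v = w" by (simp add: prod_eq_iff)
  qed
  \<comment> \<open>\<open>G\<close> puts the equations in place of the first component, so it sends
    \<open>X\<close> to points with first component 0.\<close>
  define G where "G w = ((\<chi> j i. f j i w), snd w)" for w
  define G' where "G' w v = ((\<chi> j i. frechet_derivative (f j i) (at w) v), snd v)" for w v
  have G': "(G has_derivative G' w) (at w)" for w
  proof -
    have "((\<lambda>w. \<chi> j i. f j i w) has_derivative
        (\<lambda>v. \<chi> j i. frechet_derivative (f j i) (at w) v)) (at w)"
      by (intro has_derivative_vec_lambda polynomial_fun_has_derivative f)
    from has_derivative_Pair[OF this, of snd snd] show ?thesis
      unfolding G_def G'_def
      by (simp add: bounded_linear_imp_has_derivative bounded_linear_snd)
  qed
  then have bl: "bounded_linear (G' w)" for w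
    using has_derivative_bounded_linear by blast
  have Blinfun: "blinfun_apply (Blinfun (G' w)) = G' w" for w
    by (rule bounded_linear_Blinfun_apply[OF bl])
  have cont: "continuous_on UNIV (\<lambda>w. Blinfun (G' w))"
  proof (rule continuous_on_blinfun_componentwise, unfold Blinfun)
    fix v
    show "continuous_on UNIV (\<lambda>w. G' w v)"
      unfolding G'_def
      by (intro continuous_intros continuous_on_frechet_derivative_polynomial_fun f)
  qed
  have "inj (G' a)"
  proof -
    have "v = 0" if "G' a v = 0" for v
    proof -
      have "snd v = 0" "\<And>j i. frechet_derivative (f j i) (at a) v = 0"
        using that by (auto simp: G'_def Finite_Cartesian_Product.vec_eq_iff zero_prod_def)
      moreover have "v = (fst v, 0)" using \<open>snd v = 0\<close> by (simp add: prod_eq_iff)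
      ultimately have "d j i * fst v $ j $ i = 0" for j i using df by metis
      then have "fst v = 0" using d by (simp add: Finite_Cartesian_Product.vec_eq_iff)
      with \<open>snd v = 0\<close> show ?thesis by (simp add: prod_eq_iff)
    qed
    then show ?thesis
      using bl[of a] by (simp add: linear_injective_0 bounded_linear.linear)
  qed
  \<comment> \<open>Source and target of \<open>G' a\<close> are the same finite-dimensional space,
    so a left inverse is a two-sided one.\<close>
  then obtain h where h: "linear h" "h \<circ> G' a = id"
    using linear_injective_left_inverse bl bounded_linear.linear by blast
  have hB: "blinfun_apply (Blinfun h) = h"
    using h(1) by (intro bounded_linear_Blinfun_apply) (simp add: linear_conv_bounded_linear)
  have inv: "Blinfun h o\<^sub>L Blinfun (G' a) = id_blinfun"
    by (rule blinfun_eqI) (use fun_cong[OF h(2)] in \<open>simp add: hB Blinfun\<close>)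
  have G'B: "(G has_derivative blinfun_apply (Blinfun (G' w))) (at w)" for w
    by (simp only: Blinfun G')
  obtain U V g g' where g: "open V" "G a \<in> V" "a \<in> U" "homeomorphism U V G g"
    "\<And>y. y \<in> V \<Longrightarrow> (g has_derivative g' y) (at y)"
    by (rule inverse_function_theorem[OF open_UNIV G'B cont UNIV_I inv]) blast
  have Ga: "G a = (0, snd a)" using f0[OF a] by (simp add: G_def Finite_Cartesian_Product.vec_eq_iff)
  show "snd ` zariski_tangent_space X a = UNIV"
  proof (intro equalityI subset_UNIV subsetI)
    fix \<xi> :: 'b
    \<comment> \<open>The line keeps first component 0. Its lift through the local inverse
      \<open>g\<close> is the curve \<open>\<gamma>\<close>, with velocity \<open>v\<close> at time
      0; a real parameter suffices to test derivatives.\<close>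
    define l where "l t = G a + t *\<^sub>R (0, \<xi>)" for t :: real
    define \<gamma> where "\<gamma> t = g (l t)" for t
    define v where "v = g' (G a) (0, \<xi>)"
    have l: "(l has_derivative (\<lambda>t. t *\<^sub>R (0, \<xi>))) (at 0)"
      unfolding l_def by (auto intro!: derivative_eq_intros)
    have l0: "l 0 = G a" by (simp add: l_def flip: zero_prod_def)
    have \<gamma>0: "\<gamma> 0 = a"
      using g(3,4) by (simp add: \<gamma>_def l0 homeomorphism_apply1)
    have lin': "linear (g' (G a))" by (rule has_derivative_linear[OF g(5)[OF g(2)]])
    have "(\<gamma> has_derivative (\<lambda>t. g' (G a) (t *\<^sub>R (0, \<xi>)))) (at 0)"
      unfolding \<gamma>_def
      by (rule has_derivative_compose[OF l]) (simp only: l0 g(5)[OF g(2)])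
    then have \<gamma>: "(\<gamma> has_derivative (\<lambda>t. t *\<^sub>R v)) (at 0)"
      by (simp only: v_def linear_scale[OF lin'])
    have "(l \<longlongrightarrow> G a) (at 0)"
      using has_derivative_continuous[OF l] by (simp only: continuous_within l0)
    then have "eventually (\<lambda>t. l t \<in> V) (at 0)"
      by (rule topological_tendstoD[OF _ g(1,2)])
    moreover have "((\<lambda>t. q (\<gamma> t)) \<longlongrightarrow> q a) (at 0)"
      using isCont_o2[OF has_derivative_continuous[OF \<gamma>] continuous_polynomial_fun[OF q(1)]]
      by (simp only: continuous_within \<gamma>0)
    then have "eventually (\<lambda>t. q (\<gamma> t) \<noteq> 0) (at 0)"
      by (rule tendsto_imp_eventually_ne[OF _ q(2)])
    \<comment> \<open>All equations vanish at \<open>\<gamma> t\<close>, and where \<open>q\<close>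
      is nonzero they characterize \<open>X\<close>. The filter omits t = 0, where
      \<open>\<gamma>0\<close> supplies the value.\<close>
    ultimately have X\<gamma>: "eventually (\<lambda>t. \<gamma> t \<in> X \<and> snd (\<gamma> t) = snd a + t *\<^sub>R \<xi>) (at 0)"
    proof eventually_elim
      case (elim t)
      have "G (\<gamma> t) = (0, snd a + t *\<^sub>R \<xi>)"
        using elim g(4) by (simp add: \<gamma>_def homeomorphism_apply2) (simp add: l_def Ga)
      then show ?case using elim X by (auto simp: G_def Finite_Cartesian_Product.vec_eq_iff)
    qed
    have "snd v = \<xi>"
    proof -
      have "((\<lambda>t. snd (\<gamma> t)) has_derivative (\<lambda>t. snd (t *\<^sub>R v))) (at 0)"
        by (rule has_derivative_snd[OF \<gamma>])
      then have "((\<lambda>t. snd a + t *\<^sub>R \<xi>) has_derivative (\<lambda>t. snd (t *\<^sub>R v))) (at 0)"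
        by (rule has_derivative_transform_eventually)
           (use eventually_mono[OF X\<gamma>] in \<open>simp_all add: \<gamma>0\<close>)
      moreover have "((\<lambda>t. snd a + t *\<^sub>R \<xi>) has_derivative (\<lambda>t. t *\<^sub>R \<xi>)) (at 0)"
        by (auto intro!: derivative_eq_intros)
      ultimately have "(\<lambda>t. snd (t *\<^sub>R v)) = (\<lambda>t. t *\<^sub>R \<xi>)"
        by (rule has_derivative_unique)
      from fun_cong[OF this, of 1] show ?thesis by simp
    qed
    moreover have "v \<in> zariski_tangent_space X a"
    proof -
      have "frechet_derivative p (at a) v = 0" if p: "polynomial_fun p" "\<forall>w\<in>X. p w = 0" for p
      proof -
        have "((\<lambda>t. p (\<gamma> t)) has_derivative (\<lambda>t. frechet_derivative p (at a) (t *\<^sub>R v))) (at 0)"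
          by (rule has_derivative_compose[OF \<gamma>])
             (simp add: \<gamma>0 polynomial_fun_has_derivative[OF p(1)])
        moreover have "eventually (\<lambda>t. 0 = p (\<gamma> t)) (at 0)"
          by (rule eventually_mono[OF X\<gamma>]) (simp add: p(2))
        then have "((\<lambda>t. p (\<gamma> t)) has_derivative (\<lambda>t. 0)) (at 0)"
          by (rule has_derivative_transform_eventually[OF has_derivative_const[of 0]])
             (use p(2) a in \<open>simp_all add: \<gamma>0\<close>)
        ultimately have "(\<lambda>t. frechet_derivative p (at a) (t *\<^sub>R v)) = (\<lambda>t. 0)"
          by (rule has_derivative_unique)
        from fun_cong[OF this, of 1] show ?thesis by simp
      qed
      then show ?thesis by (simp add: zariski_tangent_space_def)
    qed
    ultimately show "\<xi> \<in> snd ` zariski_tangent_space X a" by (auto intro: image_eqI)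
  qed
qed

section \<open>Upper left blocks\<close>

text \<open>In the strictly increasing list of all indices, with \<open>m\<close> at position j, the
  elements up to \<open>m\<close> occupy positions 0 to j. Hence \<open>card {..m}\<close> is
  \<open>Suc j\<close>.\<close>

lemma bij_betw_enum_index:
  fixes m :: "'n::{finite, linorder}"
  shows "bij_betw enum_index {..<card {..m}} {..m}"
proof -
  define xs where "xs = sorted_list_of_set (UNIV :: 'n set)"
  have xs: "set xs = UNIV" "distinct xs" "sorted xs" by (simp_all add: xs_def)
  have e: "enum_index = (!) xs" by (simp add: fun_eq_iff enum_index_def xs_def)
  obtain j where j: "j < length xs" "m = xs ! j"
    using xs(1) by (metis UNIV_I in_set_conv_nth)
  have le: "xs ! i \<le> xs ! k \<longleftrightarrow> i \<le> k" if "i < length xs" "k < length xs" for i k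
    using that xs(2,3) by (metis linorder_linear nth_eq_iff_index_eq sorted_nth_mono antisym)
  have "(\<lambda>k. xs ! k) ` {..j} = {..m}"
  proof (intro equalityI subsetI)
    fix y assume "y \<in> {..m}"
    then obtain i where "i < length xs" "y = xs ! i"
      using xs(1) by (metis UNIV_I in_set_conv_nth)
    with \<open>y \<in> {..m}\<close> j show "y \<in> (\<lambda>k. xs ! k) ` {..j}" by (auto simp: le)
  qed (use j le in auto)
  moreover have inj: "inj_on (\<lambda>k. xs ! k) {..j}"
    using j xs(2) by (auto simp: inj_on_def nth_eq_iff_index_eq)
  ultimately have "card {..m} = Suc j" by (metis card_atMost card_image)
  then have "{..<card {..m}} = {..j}" by (simp add: lessThan_Suc_atMost)
  with inj \<open>_ = {..m}\<close> show ?thesis by (simp add: bij_betw_def e)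
qed

lemma enum_index_le: "k < card {..m} \<Longrightarrow> enum_index k \<le> (m :: 'n::{finite, linorder})"
  using bij_betwE[OF bij_betw_enum_index] by blast

lemma upper_left_block_carrier: "upper_left_block x m \<in> carrier_mat (card {..m}) (card {..m})"
  by (simp add: upper_left_block_def)

definition block_char_poly :: "'n::{finite, linorder} \<Rightarrow> 'n cmatrix \<Rightarrow> complex poly"
  where "block_char_poly m x = char_poly (upper_left_block x m)"

lemma degree_block_char_poly: "degree (block_char_poly m x) = card {..m}"
  and block_char_poly_nonzero: "block_char_poly m x \<noteq> 0"
  using degree_monic_char_poly[OF upper_left_block_carrier, of x m]
  by (auto simp: block_char_poly_def)

lemma spectrum_upper_left_block:
  "spectrum (upper_left_block x m) = {z. poly (block_char_poly m x) z = 0}"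
  by (simp add: block_char_poly_def spectrum_root_char_poly[OF upper_left_block_carrier])

lemma polynomial_family_block_char_poly: "polynomial_family (block_char_poly m)"
  unfolding block_char_poly_def
  by (rule polynomial_family_char_poly[OF upper_left_block_carrier])
     (simp add: upper_left_block_def polynomial_fun.linear complex_linear_entry)

section \<open>The variety of matrices with generic blocks\<close>

text \<open>The characteristic polynomials being monic, the factors of the first product are their
  discriminants up to sign.\<close>

definition block_resultants :: "'n::{finite, linorder} cmatrix \<Rightarrow> complex"
  where "block_resultants x =
    (\<Prod>m\<in>UNIV. resultant (block_char_poly m x) (pderiv (block_char_poly m x))) *
    (\<Prod>k\<in>{(m, m'). next_index m m'}.
       resultant (block_char_poly (fst k) x) (block_char_poly (snd k) x))"

lemma polynomial_fun_block_resultants: "polynomial_fun block_resultants"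
  unfolding block_resultants_def
  by (intro polynomial_fun.mult polynomial_fun_prod
      polynomial_fun_resultant[OF _ _ degree_block_char_poly]
      polynomial_family_block_char_poly polynomial_family_pderiv)
     (auto simp: degree_pderiv degree_block_char_poly)

lemma block_resultants_nonzero_iff: "block_resultants x \<noteq> 0 \<longleftrightarrow> x \<in> M_Omega"
proof -
  have "resultant (block_char_poly m x) (pderiv (block_char_poly m x)) \<noteq> 0
      \<longleftrightarrow> card (spectrum (upper_left_block x m)) = card {..m}" for m
    using card_roots_iff_simple[OF block_char_poly_nonzero[of m x]]
    by (simp add: resultant_eq_0_iff_common_root block_char_poly_nonzero
        spectrum_upper_left_block degree_block_char_poly)
  moreover have "resultant (block_char_poly m x) (block_char_poly m' x) \<noteq> 0
      \<longleftrightarrow> spectrum (upper_left_block x m) \<inter> spectrum (upper_left_block x m') = {}" for m m'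
    by (auto simp: resultant_eq_0_iff_common_root block_char_poly_nonzero spectrum_upper_left_block)
  ultimately show ?thesis
    by (auto simp: block_resultants_def M_Omega_def)
qed

text \<open>A principal open set satisfies the Jacobian criterion with the empty set of
  equations.\<close>

lemma nonsingular_variety_M_Omega: "nonsingular_variety M_Omega"
  unfolding nonsingular_variety_def
  by (intro ballI exI[of _ block_resultants] exI[of _ "{}"])
     (auto simp: polynomial_fun_block_resultants block_resultants_nonzero_iff)

lemma zariski_tangent_space_M_Omega:
  "x \<in> M_Omega \<Longrightarrow> zariski_tangent_space M_Omega x = UNIV"
  by (rule zariski_tangent_space_principal_open[OF polynomial_fun_block_resultants])
     (simp_all add: block_resultants_nonzero_iff)

section \<open>The variety of matrices with ordered eigenvalues\<close>

text \<open>Its nonvanishing expresses only the open conditions of \<open>e_Omega\<close>; the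
  vanishing of the entries with i > m is left to the equations.\<close>

definition eigenvalue_differences :: "'n::{finite, linorder} cmatrix \<Rightarrow> complex"
  where "eigenvalue_differences \<nu> =
    (\<Prod>m\<in>UNIV. \<Prod>i\<in>{..m}. \<Prod>j\<in>{..m} - {i}. \<nu> $ m $ i - \<nu> $ m $ j) *
    (\<Prod>k\<in>{(m, m'). next_index m m'}. \<Prod>i\<in>{..fst k}. \<Prod>j\<in>{..snd k}.
       \<nu> $ fst k $ i - \<nu> $ snd k $ j)"

lemma polynomial_fun_eigenvalue_differences: "polynomial_fun eigenvalue_differences"
  unfolding eigenvalue_differences_def
  by (intro polynomial_fun.mult polynomial_fun_prod polynomial_fun_diff
      polynomial_fun.linear complex_linear_entry)

lemma e_Omega_iff:
  "\<nu> \<in> e_Omega \<longleftrightarrow> (\<forall>m i. m < i \<longrightarrow> \<nu> $ m $ i = 0) \<and> eigenvalue_differences \<nu> \<noteq> 0"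
proof -
  have "(\<forall>i\<in>{..m}. \<forall>j\<in>{..m} - {i}. \<nu> $ m $ i - \<nu> $ m $ j \<noteq> 0) \<longleftrightarrow> inj_on (\<lambda>i. \<nu> $ m $ i) {..m}" for m
    unfolding inj_on_def by auto
  then show ?thesis
    unfolding e_Omega_def eigenvalue_differences_def by auto
qed

text \<open>There is one equation for each entry of the square array, including those above
  \<open>m\<close>. This makes the Jacobian with respect to \<nu> square and diagonal.\<close>

definition eigenvalue_equation ::
    "'n::{finite, linorder} \<Rightarrow> 'n \<Rightarrow> 'n cmatrix \<times> 'n cmatrix \<Rightarrow> complex"
  where "eigenvalue_equation m i w =
    (if i \<le> m then poly (block_char_poly m (snd w)) (fst w $ m $ i) else fst w $ m $ i)"

lemma polynomial_fun_eigenvalue_equation: "polynomial_fun (eigenvalue_equation m i)"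
proof -
  have entry: "polynomial_fun (\<lambda>w :: 'a cmatrix \<times> 'a cmatrix. fst w $ m $ i)"
    by (intro polynomial_fun.linear complex_linear_compose[OF complex_linear_entry] complex_linear_fst)
  have "polynomial_family (\<lambda>w :: 'a cmatrix \<times> 'a cmatrix. block_char_poly m (snd w))"
    using polynomial_family_block_char_poly[of m]
    by (auto simp: polynomial_family_def intro: polynomial_fun_compose_linear[OF _ complex_linear_snd])
  then show ?thesis
    unfolding eigenvalue_equation_def
    by (intro polynomial_fun_if polynomial_fun_poly[OF _ _ degree_block_char_poly] entry)
qed

text \<open>Similar matrices share their characteristic polynomial, so the diagonal entries are
  roots. Conversely, distinct roots in the full number are distinct eigenvalues, and these
  diagonalize the block.\<close>

lemma similar_blocks_iff:
  assumes "inj_on (\<lambda>i. \<nu> $ m $ i) {..m}"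
  shows "similar_mat (diagonal_block \<nu> m) (upper_left_block x m) \<longleftrightarrow>
    (\<forall>i\<le>m. poly (block_char_poly m x) (\<nu> $ m $ i) = 0)"
proof
  assume "similar_mat (diagonal_block \<nu> m) (upper_left_block x m)"
  then have "block_char_poly m x
      = (\<Prod>k\<leftarrow>[0..<card {..m}]. [:- (\<nu> $ m $ enum_index k), 1:])"
    unfolding block_char_poly_def char_poly_mat_diag[symmetric] diagonal_block_def[symmetric]
    by (rule char_poly_similar[symmetric])
  then have roots: "poly (block_char_poly m x) z = 0
      \<longleftrightarrow> (\<exists>k<card {..m}. z = \<nu> $ m $ enum_index k)" for z
    by (auto simp: poly_prod_list prod_list_zero_iff)
  show "\<forall>i\<le>m. poly (block_char_poly m x) (\<nu> $ m $ i) = 0"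
  proof (intro allI impI)
    fix i assume "i \<le> m"
    then have "i \<in> enum_index ` {..<card {..m}}"
      using bij_betw_imp_surj_on[OF bij_betw_enum_index[of m]] by simp
    then show "poly (block_char_poly m x) (\<nu> $ m $ i) = 0"
      unfolding roots by auto
  qed
next
  assume root: "\<forall>i\<le>m. poly (block_char_poly m x) (\<nu> $ m $ i) = 0"
  have "inj_on ((\<lambda>i. \<nu> $ m $ i) \<circ> enum_index) {..<card {..m}}"
    using bij_betw_enum_index[of m] assms by (intro comp_inj_on) (auto simp: bij_betw_def)
  then show "similar_mat (diagonal_block \<nu> m) (upper_left_block x m)"
    unfolding diagonal_block_def
    using root enum_index_le
    by (intro similar_mat_diag_of_eigenvalues[OF upper_left_block_carrier])
       (auto simp: comp_def eigenvalue_root_char_poly[OF upper_left_block_carrier] block_char_poly_def)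
qed

text \<open>The entries already provide as many distinct roots as the degree allows.\<close>

lemma roots_block_char_poly:
  assumes "inj_on (\<lambda>i. \<nu> $ m $ i) {..m}"
    and "\<forall>i\<le>m. poly (block_char_poly m x) (\<nu> $ m $ i) = 0"
  shows "{z. poly (block_char_poly m x) z = 0} = (\<lambda>i. \<nu> $ m $ i) ` {..m}"
proof (rule card_seteq[symmetric])
  show "finite {z. poly (block_char_poly m x) z = 0}"
    using block_char_poly_nonzero by (rule poly_roots_finite)
  show "card {z. poly (block_char_poly m x) z = 0} \<le> card ((\<lambda>i. \<nu> $ m $ i) ` {..m})"
    using card_poly_roots_bound[OF block_char_poly_nonzero[of m x]]
    by (simp add: card_image[OF assms(1)] degree_block_char_poly)
qed (use assms(2) in auto)

lemma M_Omega_e_iff: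
  "w \<in> M_Omega_e \<longleftrightarrow>
    eigenvalue_differences (fst w) \<noteq> 0 \<and> (\<forall>m i. eigenvalue_equation m i w = 0)"
proof (cases w)
  case (Pair \<nu> x)
  have "(\<forall>m i. eigenvalue_equation m i w = 0) \<longleftrightarrow>
      (\<forall>m i. m < i \<longrightarrow> \<nu> $ m $ i = 0) \<and> (\<forall>m. \<forall>i\<le>m. poly (block_char_poly m x) (\<nu> $ m $ i) = 0)"
    by (auto simp: eigenvalue_equation_def Pair not_le)
  moreover have "(\<forall>m. similar_mat (diagonal_block \<nu> m) (upper_left_block x m)) \<longleftrightarrow>
      (\<forall>m. \<forall>i\<le>m. poly (block_char_poly m x) (\<nu> $ m $ i) = 0)" if "\<nu> \<in> e_Omega"
    using that by (simp add: similar_blocks_iff e_Omega_def)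
  \<comment> \<open>The entries of \<nu> are exactly the eigenvalues of the blocks, so their
    distinctness and disjointness carry over to the spectra.\<close>
  moreover have "x \<in> M_Omega" if "\<nu> \<in> e_Omega"
    and root: "\<forall>m. \<forall>i\<le>m. poly (block_char_poly m x) (\<nu> $ m $ i) = 0"
  proof -
    have inj: "inj_on (\<lambda>i. \<nu> $ m $ i) {..m}" for m
      using that(1) by (simp add: e_Omega_def)
    have spec: "spectrum (upper_left_block x m) = (\<lambda>i. \<nu> $ m $ i) ` {..m}" for m
      unfolding spectrum_upper_left_block by (rule roots_block_char_poly[OF inj]) (use root in auto)
    then show ?thesis
      using that(1) by (auto simp: M_Omega_def card_image[OF inj] e_Omega_def)
  qed
  ultimately show ?thesis
    unfolding Pair M_Omega_e_def by (auto simp: e_Omega_iff)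
qed

lemma eigenvalue_equation_partial_derivative:
  "frechet_derivative (eigenvalue_equation m i) (at w) (\<eta>, 0) =
    (if i \<le> m then poly (pderiv (block_char_poly m (snd w))) (fst w $ m $ i) else 1) * \<eta> $ m $ i"
proof -
  \<comment> \<open>With the matrix frozen, the equation is a one-variable polynomial in a single
    entry. Its derivative is found both through this inclusion and directly, and the two agree by
    uniqueness.\<close>
  have "((\<lambda>\<nu>. (\<nu>, snd w)) has_derivative (\<lambda>\<eta>. (\<eta>, 0))) (at (fst w))"
    by (intro has_derivative_Pair has_derivative_ident has_derivative_const)
  from has_derivative_compose[OF this, of "eigenvalue_equation m i"]
  have "((\<lambda>\<nu>. eigenvalue_equation m i (\<nu>, snd w)) has_derivative
      (\<lambda>\<eta>. frechet_derivative (eigenvalue_equation m i) (at w) (\<eta>, 0))) (at (fst w))"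
    by (simp add: polynomial_fun_has_derivative[OF polynomial_fun_eigenvalue_equation])
  moreover have entry: "((\<lambda>\<nu>. \<nu> $ m $ i) has_derivative (\<lambda>\<eta>. \<eta> $ m $ i)) (at (fst w))"
    by (intro bounded_linear_imp_has_derivative complex_linear_bounded_linear complex_linear_entry)
  have "((\<lambda>\<nu>. poly p (\<nu> $ m $ i)) has_derivative
      (\<lambda>\<eta>. poly (pderiv p) (fst w $ m $ i) * \<eta> $ m $ i)) (at (fst w))" for p
    by (rule has_derivative_compose[OF entry])
       (use poly_DERIV[of p] in \<open>simp add: has_field_derivative_def\<close>)
  with entry have "((\<lambda>\<nu>. eigenvalue_equation m i (\<nu>, snd w)) has_derivative
      (\<lambda>\<eta>. (if i \<le> m then poly (pderiv (block_char_poly m (snd w))) (fst w $ m $ i) else 1)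
         * \<eta> $ m $ i)) (at (fst w))"
    by (simp add: eigenvalue_equation_def)
  ultimately have "(\<lambda>\<eta>. frechet_derivative (eigenvalue_equation m i) (at w) (\<eta>, 0)) =
      (\<lambda>\<eta>. (if i \<le> m then poly (pderiv (block_char_poly m (snd w))) (fst w $ m $ i) else 1)
         * \<eta> $ m $ i)"
    by (rule has_derivative_unique)
  from fun_cong[OF this, of \<eta>] show ?thesis .
qed

text \<open>On \<open>M_Omega\<close> the characteristic polynomial of each block has as many roots
  as its degree, so each eigenvalue is a simple root.\<close>

lemma eigenvalue_equation_partial_derivative_nonzero:
  assumes "w \<in> M_Omega_e"
  shows "(if i \<le> m then poly (pderiv (block_char_poly m (snd w))) (fst w $ m $ i) else 1) \<noteq> 0"
proof (cases "i \<le> m")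
  case True
  have "snd w \<in> M_Omega" using assms by (auto simp: M_Omega_e_def)
  then have "card {z. poly (block_char_poly m (snd w)) z = 0} = degree (block_char_poly m (snd w))"
    by (simp add: M_Omega_def spectrum_upper_left_block degree_block_char_poly)
  moreover have "poly (block_char_poly m (snd w)) (fst w $ m $ i) = 0"
    using assms True by (auto simp: M_Omega_e_iff eigenvalue_equation_def dest: spec2[of _ m i])
  ultimately show ?thesis
    using True simple_root_of_card_roots[OF block_char_poly_nonzero] by simp
qed simp

lemma polynomial_fun_eigenvalue_differences_fst:
  "polynomial_fun (\<lambda>w :: 'n::{finite, linorder} cmatrix \<times> 'n cmatrix. eigenvalue_differences (fst w))"
  by (rule polynomial_fun_compose_linear[OF polynomial_fun_eigenvalue_differences complex_linear_fst])

lemma nonsingular_variety_M_Omega_e: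
  "nonsingular_variety (M_Omega_e :: ('n::{finite, linorder} cmatrix \<times> 'n cmatrix) set)"
  unfolding nonsingular_variety_def
proof
  fix a :: "'n cmatrix \<times> 'n cmatrix" assume a: "a \<in> M_Omega_e"
  let ?F = "range (\<lambda>(m :: 'n, i :: 'n). eigenvalue_equation m i)"
  have "\<forall>p\<in>?F. c p = 0" if "\<forall>v. (\<Sum>p\<in>?F. c p * frechet_derivative p (at a) v) = 0" for c
    using independent_differentials_of_diagonal[OF eigenvalue_equation_partial_derivative_nonzero[OF a]
        eigenvalue_equation_partial_derivative, of c] that by auto
  then show "\<exists>q F. polynomial_fun q \<and> q a \<noteq> 0 \<and> finite F \<and> (\<forall>p\<in>F. polynomial_fun p) \<and>
      (\<forall>w. q w \<noteq> 0 \<longrightarrow> (w \<in> M_Omega_e \<longleftrightarrow> (\<forall>p\<in>F. p w = 0))) \<and>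
      (\<forall>c :: ('n cmatrix \<times> 'n cmatrix \<Rightarrow> complex) \<Rightarrow> complex.
        (\<forall>v. (\<Sum>p\<in>F. c p * frechet_derivative p (at a) v) = 0) \<longrightarrow> (\<forall>p\<in>F. c p = 0))"
    using a polynomial_fun_eigenvalue_equation
    by (intro exI[of _ "\<lambda>w. eigenvalue_differences (fst w)"] exI[of _ ?F] conjI
        polynomial_fun_eigenvalue_differences_fst) (auto simp: M_Omega_e_iff)
qed

lemma snd_bij_zariski_tangent_space_M_Omega_e:
  assumes "a \<in> M_Omega_e"
  shows "bij_betw snd (zariski_tangent_space M_Omega_e a) UNIV"
  by (rule snd_bij_zariski_tangent_space[OF polynomial_fun_eigenvalue_equation
        polynomial_fun_eigenvalue_differences_fst _ _ assms _
        eigenvalue_equation_partial_derivative_nonzero[OF assms] eigenvalue_equation_partial_derivative])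
     (use assms in \<open>auto simp: M_Omega_e_iff\<close>)

section \<open>The projection\<close>

lemma complex_differentiable_at_linear: "complex_linear f \<Longrightarrow> complex_differentiable_at f w"
  unfolding complex_differentiable_at_def
  using complex_linear_bounded_linear bounded_linear_imp_has_derivative by blast

lemma analytic_isomorphism_graph:
  fixes \<phi> :: "'a::complex_space \<Rightarrow> 'b::complex_space"
  assumes "analytic_map_on \<phi> U"
  shows "analytic_isomorphism (graph_map \<phi> ` U) U snd"
proof -
  have bij: "bij_betw snd (graph_map \<phi> ` U) U"
    by (auto simp: bij_betw_def inj_on_def graph_map_def image_image)
  have "analytic_map_on (snd :: 'b \<times> 'a \<Rightarrow> 'a) (graph_map \<phi> ` U)"
    unfolding analytic_map_on_def
    by (intro ballI exI[of _ UNIV] exI[of _ snd])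
       (simp add: complex_differentiable_at_linear complex_linear_snd)
  moreover have "analytic_map_on (inv_into (graph_map \<phi> ` U) snd) U"
    unfolding analytic_map_on_def
  proof
    fix a assume "a \<in> U"
    from bspec[OF assms[unfolded analytic_map_on_def] this]
    obtain W g where W: "open W" "a \<in> W" and g: "\<forall>w\<in>W. complex_differentiable_at g w"
      and eq: "\<forall>w\<in>U \<inter> W. g w = \<phi> w"
      by (elim exE conjE)
    \<comment> \<open>The inverse of the projection sends y to (\<phi> y, y), so pairing a local
      extension of \<phi> with the identity extends it.\<close>
    have "complex_differentiable_at (\<lambda>w. (g w, w)) w" if w: "w \<in> W" for w
    proof -
      obtain g' where "(g has_derivative g') (at w)" "complex_linear g'"
        using bspec[OF g w] unfolding complex_differentiable_at_def by (elim exE conjE)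
      then show ?thesis
        unfolding complex_differentiable_at_def complex_linear_def
        by (intro exI[of _ "\<lambda>v. (g' v, v)"])
           (auto simp: scaleC_prod_def intro!: has_derivative_Pair bounded_linear_Pair)
    qed
    moreover have "(g w, w) = inv_into (graph_map \<phi> ` U) snd w" if "w \<in> U \<inter> W" for w
      using that eq bij_betw_imp_inj_on[OF bij]
      by (intro inv_into_f_eq[symmetric]) (auto simp: graph_map_def)
    ultimately show "\<exists>W g. open W \<and> a \<in> W \<and> (\<forall>w\<in>W. complex_differentiable_at g w) \<and>
        (\<forall>w\<in>U \<inter> W. g w = inv_into (graph_map \<phi> ` U) snd w)"
      using W by (intro exI[of _ W] exI[of _ "\<lambda>w. (g w, w)"]) auto
  qed
  ultimately show ?thesis using bij by (simp add: analytic_isomorphism_def)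
qed

section \<open>Etaleness of the projection\<close>

lemma regular_representation_linear:
  assumes "complex_linear f"
  shows "regular_representation X f a f"
proof -
  \<comment> \<open>The denominator is the constant 1, which acts trivially because complex scaling
    extends real scaling.\<close>
  have "f = (\<lambda>w. inverse 1 *\<^sub>C f w)"
    by (simp add: fun_eq_iff scaleC_of_real[of 1, simplified])
  moreover have "polynomial_map f"
    by (auto simp: polynomial_map_def intro: polynomial_fun.linear complex_linear_compose assms)
  ultimately show ?thesis
    unfolding regular_representation_def
    by (intro exI[of _ f] exI[of _ "\<lambda>w. 1"]) (auto intro: polynomial_fun.const)
qed

lemma etale_morphism_pi_n:
  "etale_morphism (M_Omega_e :: ('n::{finite, linorder} cmatrix \<times> 'n cmatrix) set) M_Omega pi_n"
  unfolding etale_morphism_def regular_map_def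
proof (intro conjI ballI nonsingular_variety_M_Omega nonsingular_variety_M_Omega_e)
  show img: "pi_n ` M_Omega_e \<subseteq> (M_Omega :: 'n cmatrix set)"
    by (auto simp: M_Omega_e_def pi_n_def)
  fix a :: "'n cmatrix \<times> 'n cmatrix" assume a: "a \<in> M_Omega_e"
  have rep: "regular_representation M_Omega_e pi_n a snd"
    unfolding pi_n_def by (rule regular_representation_linear[OF complex_linear_snd])
  then show "\<exists>g. regular_representation M_Omega_e pi_n a g" by blast
  \<comment> \<open>The projection is linear, hence its own differential, and the tangent space of
    its target is the whole matrix space.\<close>
  have "(snd has_derivative snd) (at a)"
    by (intro bounded_linear_imp_has_derivative bounded_linear_snd)
  then have "frechet_derivative snd (at a) = snd"
    by (rule frechet_derivative_at[symmetric])
  moreover have "zariski_tangent_space M_Omega (pi_n a) = UNIV"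
    using img a by (intro zariski_tangent_space_M_Omega) auto
  ultimately show "\<exists>g. regular_representation M_Omega_e pi_n a g \<and>
      bij_betw (frechet_derivative g (at a))
        (zariski_tangent_space M_Omega_e a) (zariski_tangent_space M_Omega (pi_n a))"
    using rep snd_bij_zariski_tangent_space_M_Omega_e[OF a] by (intro exI[of _ snd]) simp
qed

theorem proposition4p13:
  shows "(\<forall>(\<nu> :: 'n::{finite, linorder} cmatrix) x U \<phi> U\<^sub>z.
      (\<nu>, x) \<in> M_Omega_e \<and>
      connected U \<and> openin (top_of_set M_Omega) U \<and> x \<in> U \<and>
      \<phi> ` U \<subseteq> e_Omega \<and> analytic_map_on \<phi> U \<and>
      graph_map \<phi> x = (\<nu>, x) \<and>
      U\<^sub>z = graph_map \<phi> ` U \<and>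
      U\<^sub>z \<subseteq> M_Omega_e \<and>
      (\<exists>h. homeomorphism U U\<^sub>z (graph_map \<phi>) h) \<and>
      M_Omega_e \<inter> pi_n -` U = (\<Union>\<sigma>\<in>Sigma_n. Sigma_act \<sigma> ` U\<^sub>z) \<and>
      disjoint_family_on (\<lambda>\<sigma>. Sigma_act \<sigma> ` U\<^sub>z) Sigma_n \<and>
      components (M_Omega_e \<inter> pi_n -` U) = (\<lambda>\<sigma>. Sigma_act \<sigma> ` U\<^sub>z) ` Sigma_n \<and>
      (\<forall>\<sigma>\<in>Sigma_n. openin (top_of_set M_Omega_e) (Sigma_act \<sigma> ` U\<^sub>z))
      \<longrightarrow> analytic_isomorphism U\<^sub>z U pi_n)
    \<and> etale_morphism (M_Omega_e :: ('n cmatrix \<times> 'n cmatrix) set) M_Omega pi_n"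
proof (intro conjI allI impI etale_morphism_pi_n; elim conjE)
  fix U U\<^sub>z and \<phi> :: "'n cmatrix \<Rightarrow> 'n cmatrix"
  assume "analytic_map_on \<phi> U" "U\<^sub>z = graph_map \<phi> ` U"
  then show "analytic_isomorphism U\<^sub>z U pi_n"
    unfolding pi_n_def by (simp add: analytic_isomorphism_graph)
qed

end
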